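(* Let $B\subseteq \mathbb{N}^+$ be an infinite set with increasing enumeration $(b_n: n \in \mathbb{N}^+)$. Suppose that there exists a function $r: \mathbb{N}^+ \to \mathbb{N}^+$ for which the following hold: (i) $r(n)<n$ for all $n \ge 2$; (ii) $r(n)=o(n)$ as $n\to \infty$; (iii) $\mathsf{d}(E_r)=0$, where $E_r:=\bigcup_{k\ge 2} \left([b_k,\,b_k+b_{k-r(k)}) \cap \mathbb{N}^+\right)$. Then for each $\alpha \in [0,1]$ there exists a set $A\subseteq \mathbb{N}^+$ such that $\mathsf{d}(A)=0$ and $\mathsf{d}(A+B)=\alpha$.
   Context: $\mathbb{N}^+=\{1,2,\ldots\}$. For $S\subseteq \mathbb{N}^+$, the asymptotic density is $\mathsf{d}(S):=\lim_{n\to\infty} |S\cap[1,n]|/n$, provided the limit exists; "$\mathsf{d}(S)=\alpha$" means that the limit exists and equals $\alpha$. The sumset is $A+B:=\{x+y: x\in A, y\in B\}$. *)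

theory Defs
  imports Complex_Main "HOL-Library.Set_Algebras" "HOL-Library.Landau_Symbols"
begin

definition has_density :: "nat set \<Rightarrow> real \<Rightarrow> bool" where
  "has_density S \<alpha> \<longleftrightarrow> (\<lambda>n. real (card (S \<inter> {1..n})) / real n) \<longlonglongrightarrow> \<alpha>"

definition increasing_enumeration :: "(nat \<Rightarrow> nat) \<Rightarrow> nat set \<Rightarrow> bool" where
  "increasing_enumeration b B \<longleftrightarrow> strict_mono_on {1..} b \<and> b ` {1..} = B"

(* The truncated subtraction k - r k is harmless whenever r k < k for all k \<ge> 2;
   then the index k - r k is at least 1. *)
definition exceptional_set :: "(nat \<Rightarrow> nat) \<Rightarrow> (nat \<Rightarrow> nat) \<Rightarrow> nat set" where
  "exceptional_set b r = (\<Union>k\<in>{2..}. {b k ..< b k + b (k - r k)} \<inter> {1..})"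

end

theory Submission
  imports Defs "HOL-Probability.Probability" "HOL-Real_Asymp.Real_Asymp"
begin

text \<open>
  Let \<open>c(n) = |B \<inter> [1, n]|\<close> and put each \<open>a \<ge> 1\<close> into \<open>A\<close> independently with probability
  \<open>1 - exp (- w(a))\<close>, where \<open>w(a) = - ln (1 - \<alpha>) / c(a)\<close> if \<open>\<alpha> < 1\<close> and \<open>w(a) = 1 / sqrt c(a)\<close>
  if \<open>\<alpha> = 1\<close>. If \<open>n\<close> is not exceptional and \<open>k = c(n)\<close>, then every \<open>a = n - x\<close> with \<open>x \<in> B\<close>,
  \<open>x < n\<close>, satisfies \<open>k - r(k) \<le> c(a) \<le> k\<close>, and there are exactly \<open>k\<close> of them; as \<open>r(k) = o(k)\<close>,
  the probability that \<open>n\<close> is not in \<open>A + B\<close> tends to \<open>1 - \<alpha>\<close>. Since the exceptional set is null,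
  \<open>c(N) = O(N\<^sup>1\<^sup>/\<^sup>4)\<close>, so the number of \<open>n \<le> N\<close> missed by \<open>A + B\<close> has variance at most
  \<open>N c(N)\<^sup>2 = O(N\<^sup>3\<^sup>/\<^sup>2)\<close>. Along \<open>N = j\<^sup>4\<close> the normalised variances are summable, which gives
  almost sure convergence of the averages there, and hence along all \<open>N\<close>.
\<close>

section \<open>Almost sure convergence of averages of weakly correlated events\<close>

text \<open>\<open>D\<close> moves by at most 1 per step, hence by at most (j + 1)^4 - j^4 = O(j^3)
  between consecutive fourth powers, which is negligible against j^4.\<close>

lemma average_tendsto_0_from_fourth_powers:
  fixes D :: "nat \<Rightarrow> real"
  assumes step: "\<And>m n. m \<le> n \<Longrightarrow> \<bar>D n - D m\<bar> \<le> real n - real m"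
    and lim: "(\<lambda>j. D (j ^ 4) / real (j ^ 4)) \<longlonglongrightarrow> 0"
  shows "(\<lambda>N. D N / real N) \<longlonglongrightarrow> 0"
proof -
  \<comment> \<open>\<open>f N\<close> is the largest \<open>j\<close> with
    \<open>j ^ 4 \<le> N\<close>. For \<open>j \<ge> 1\<close>, \<open>g j\<close> dominates the
    average at every \<open>N\<close> from \<open>j ^ 4\<close> up to
    \<open>(j + 1) ^ 4\<close>.\<close>
  define f :: "nat \<Rightarrow> nat" where "f N = nat \<lfloor>root 4 (real N)\<rfloor>" for N
  define g :: "nat \<Rightarrow> real" where
    "g j = \<bar>D (j ^ 4) / real (j ^ 4)\<bar> + ((real j + 1) ^ 4 - real j ^ 4) / real j ^ 4" for j
  have "g \<longlonglongrightarrow> 0"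
  proof -
    have "(\<lambda>j::nat. ((real j + 1) ^ 4 - real j ^ 4) / real j ^ 4) \<longlonglongrightarrow> 0"
      by real_asymp
    with tendsto_rabs_zero[OF lim] show ?thesis
      unfolding g_def using tendsto_add_zero by blast
  qed
  moreover have "filterlim f at_top sequentially"
  proof -
    have "filterlim (\<lambda>N. nat \<lfloor>root 4 (real N)\<rfloor>) at_top sequentially"
      by real_asymp
    then show ?thesis unfolding f_def .
  qed
  ultimately have g_f: "(\<lambda>N. g (f N)) \<longlonglongrightarrow> 0"
    by (rule filterlim_compose)
  have bound: "norm (D N / real N) \<le> g (f N)" if "N \<ge> 1" for N
  proof -
    define j where "j = f N"
    have j_le: "real j \<le> root 4 (real N)" and j_gt: "root 4 (real N) < real j + 1"
      unfolding j_def f_def by auto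
    have "1 \<le> root 4 (real N)" using that by simp
    with j_gt have "j \<ge> 1" by linarith
    have root_pow: "root 4 (real N) ^ 4 = real N" by simp
    have le: "real j ^ 4 \<le> real N"
      using power_mono[OF j_le, of 4] root_pow by simp
    have lt: "real N < (real j + 1) ^ 4"
      using power_strict_mono[OF j_gt, of 4] root_pow by simp
    have "j ^ 4 \<le> N" using le by (metis of_nat_le_iff of_nat_power)
    then have "\<bar>D N - D (j ^ 4)\<bar> \<le> real N - real j ^ 4"
      using step[of "j ^ 4" N] by simp
    then have "\<bar>D N\<bar> \<le> \<bar>D (j ^ 4)\<bar> + ((real j + 1) ^ 4 - real j ^ 4)"
      using lt by linarith
    moreover have "0 < real j ^ 4" using \<open>j \<ge> 1\<close> by simp
    ultimately have "\<bar>D N\<bar> / real N \<le> (\<bar>D (j ^ 4)\<bar> + ((real j + 1) ^ 4 - real j ^ 4)) / real j ^ 4"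
      using le by (intro frac_le) auto
    then show ?thesis
      unfolding g_def j_def[symmetric] by (simp add: add_divide_distrib)
  qed
  show ?thesis
    by (rule Lim_null_comparison[OF eventually_sequentiallyI[OF bound] g_f])
qed

text \<open>The left side of \<open>cov\<close> is the variance of the number of events that occur
  among the first \<open>N\<close>. At N = j^4 the normalised variance is at most |K| j^6 / j^8 =
  |K| / j^2, which is summable. So the squared averages have an almost surely finite sum and tend to
  0 along fourth powers; the preceding lemma fills the gaps.\<close>

lemma (in prob_space) AE_average_indicator_minus_prob:
  fixes V :: "nat \<Rightarrow> 'a set"
  assumes V [measurable]: "\<And>n. V n \<in> events"
    and cov: "\<And>N. (\<Sum>n=1..N. \<Sum>m=1..N. prob (V n \<inter> V m) - prob (V n) * prob (V m))
                \<le> K * (real N * sqrt (real N))"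
  shows "AE \<omega> in M. (\<lambda>N. (\<Sum>n=1..N. indicator (V n) \<omega> - prob (V n)) / real N) \<longlonglongrightarrow> 0"
proof -
  define D where "D N \<omega> = (\<Sum>n=1..N. indicator (V n) \<omega> - prob (V n))" for N \<omega>
  define F where "F j \<omega> = (D (j ^ 4) \<omega> / real (j ^ 4))\<^sup>2" for j \<omega>
  have [measurable]: "D N \<in> borel_measurable M" for N
    unfolding D_def by measurable
  have [measurable]: "F j \<in> borel_measurable M" for j
    unfolding F_def by measurable
  have D_sq: "(D N \<omega>)\<^sup>2 = (\<Sum>n=1..N. \<Sum>m=1..N.
      indicator (V n \<inter> V m) \<omega> - prob (V m) * indicator (V n) \<omega>
        - prob (V n) * indicator (V m) \<omega> + prob (V n) * prob (V m))" for N \<omega>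
    unfolding D_def power2_eq_square sum_product
    by (intro sum.cong refl) (simp add: algebra_simps indicator_inter_arith)
  have integrable: "integrable M (\<lambda>\<omega>. (D N \<omega>)\<^sup>2)" for N
    unfolding D_sq by (auto simp: emeasure_eq_measure)
  have integral: "(\<integral>\<omega>. (D N \<omega>)\<^sup>2 \<partial>M)
      = (\<Sum>n=1..N. \<Sum>m=1..N. prob (V n \<inter> V m) - prob (V n) * prob (V m))" for N
    unfolding D_sq by (auto simp: emeasure_eq_measure prob_space intro!: sum.cong)
  \<comment> \<open>No sign of \<open>K\<close> is assumed; \<open>\<bar>K\<bar>\<close> keeps the
    bound nonnegative, as the later sum in \<open>ennreal\<close> requires.\<close>
  have F_le: "(\<integral>\<^sup>+\<omega>. ennreal (F j \<omega>) \<partial>M) \<le> ennreal (\<bar>K\<bar> * (1 / real j ^ 2))" for j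
  proof -
    have "(\<integral>\<^sup>+\<omega>. ennreal (F j \<omega>) \<partial>M) = ennreal (\<integral>\<omega>. F j \<omega> \<partial>M)"
      using integrable[of "j ^ 4"]
      by (intro nn_integral_eq_integral) (auto simp: F_def power_divide)
    also have "(\<integral>\<omega>. F j \<omega> \<partial>M) = (\<integral>\<omega>. (D (j ^ 4) \<omega>)\<^sup>2 \<partial>M) / (real j ^ 4)\<^sup>2"
      by (simp add: F_def power_divide)
    also have "\<dots> \<le> \<bar>K\<bar> * (real (j ^ 4) * sqrt (real (j ^ 4))) / (real j ^ 4)\<^sup>2"
    proof (intro divide_right_mono)
      have "K * (real (j ^ 4) * sqrt (real (j ^ 4))) \<le> \<bar>K\<bar> * (real (j ^ 4) * sqrt (real (j ^ 4)))"
        by (intro mult_right_mono) auto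
      with cov[of "j ^ 4"] show "(\<integral>\<omega>. (D (j ^ 4) \<omega>)\<^sup>2 \<partial>M) \<le> \<bar>K\<bar> * (real (j ^ 4) * sqrt (real (j ^ 4)))"
        unfolding integral by linarith
    qed auto
    also have "sqrt (real (j ^ 4)) = real j ^ 2"
      by (rule real_sqrt_unique) auto
    \<comment> \<open>At \<open>j = 0\<close> both sides are 0, since division by zero gives
      0.\<close>
    also have "\<bar>K\<bar> * (real (j ^ 4) * real j ^ 2) / (real j ^ 4)\<^sup>2 = \<bar>K\<bar> * (1 / real j ^ 2)"
      by (cases "j = 0") (auto simp: field_simps power_add[symmetric] power_mult[symmetric])
    finally show ?thesis by (simp add: ennreal_leI)
  qed
  have "summable (\<lambda>j::nat. \<bar>K\<bar> * (1 / real j ^ 2))"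
    using inverse_power_summable[of 2, where ?'a = real]
    by (intro summable_mult) (simp add: inverse_eq_divide)
  then have "(\<Sum>j. ennreal (\<bar>K\<bar> * (1 / real j ^ 2))) \<noteq> \<infinity>"
    by (subst suminf_ennreal2) auto
  moreover have "(\<integral>\<^sup>+\<omega>. (\<Sum>j. ennreal (F j \<omega>)) \<partial>M) \<le> (\<Sum>j. ennreal (\<bar>K\<bar> * (1 / real j ^ 2)))"
    using F_le by (subst nn_integral_suminf) (auto intro!: suminf_le)
  ultimately have "(\<integral>\<^sup>+\<omega>. (\<Sum>j. ennreal (F j \<omega>)) \<partial>M) \<noteq> \<infinity>"
    unfolding infinity_ennreal_def by (rule neq_top_trans)
  then have "AE \<omega> in M. (\<Sum>j. ennreal (F j \<omega>)) \<noteq> \<infinity>"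
    by (intro nn_integral_noteq_infinite) auto
  then show ?thesis
  proof eventually_elim
    case (elim \<omega>)
    then have "summable (\<lambda>j. F j \<omega>)"
      by (intro summable_suminf_not_top) (auto simp: F_def)
    then have "(\<lambda>j. F j \<omega>) \<longlonglongrightarrow> 0"
      by (rule summable_LIMSEQ_zero)
    then have "(\<lambda>j. D (j ^ 4) \<omega> / real (j ^ 4)) \<longlonglongrightarrow> 0"
      unfolding F_def by (simp only: power_tendsto_0_iff zero_less_numeral)
    moreover have "\<bar>D n \<omega> - D m \<omega>\<bar> \<le> real n - real m" if "m \<le> n" for m n
    proof -
      have "{1..n} - {1..m} = {m<..n}" by auto
      then have "D n \<omega> - D m \<omega> = (\<Sum>i\<in>{m<..n}. indicator (V i) \<omega> - prob (V i))"
        unfolding D_def using that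
        by (subst sum_diff[of "{1..n}" "{1..m}", symmetric]) simp_all
      also have "\<bar>\<dots>\<bar> \<le> (\<Sum>i\<in>{m<..n}. 1)"
      proof (intro order_trans[OF sum_abs] sum_mono)
        show "\<bar>indicator (V i) \<omega> - prob (V i)\<bar> \<le> 1" for i
          using prob_le_1[of "V i"] measure_nonneg[of M "V i"]
          by (cases "\<omega> \<in> V i") (simp_all add: abs_le_iff)
      qed
      finally show ?thesis using that by simp
    qed
    ultimately show ?case
      unfolding D_def[symmetric] by (intro average_tendsto_0_from_fourth_powers)
  qed
qed

section \<open>Random subsets with independent memberships\<close>

text \<open>A random set is encoded by its indicator function, so that independence of the
  memberships is the product structure of the measure.\<close>

definition random_subset :: "(nat \<Rightarrow> real) \<Rightarrow> (nat \<Rightarrow> bool) measure" where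
  "random_subset p = (\<Pi>\<^sub>M a\<in>UNIV. measure_pmf (bernoulli_pmf (p a)))"

lemma prob_space_random_subset: "prob_space (random_subset p)"
  unfolding random_subset_def by (intro prob_space_PiM prob_space_measure_pmf)

lemma space_random_subset [simp]: "space (random_subset p) = UNIV"
  by (simp add: random_subset_def space_PiM PiE_UNIV_domain)

lemma avoid_in_sets_random_subset:
  assumes "finite S"
  shows "{\<omega>. \<forall>a\<in>S. \<not> \<omega> a} \<in> sets (random_subset p)"
proof -
  have "{\<omega> \<in> space (random_subset p). \<forall>a\<in>S. \<not> \<omega> a} \<in> sets (random_subset p)"
    using assms unfolding random_subset_def by measurable
  then show ?thesis by simp
qed

lemma measure_random_subset_avoid:
  assumes "finite S" "\<And>a. p a \<in> {0..1}"
  shows "measure (random_subset p) {\<omega>. \<forall>a\<in>S. \<not> \<omega> a} = (\<Prod>a\<in>S. 1 - p a)"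
proof -
  interpret product_prob_space "\<lambda>a. measure_pmf (bernoulli_pmf (p a))" UNIV
    by (simp add: product_prob_space_def product_prob_space_axioms_def
        product_sigma_finite_def prob_space_measure_pmf measure_pmf.sigma_finite_measure_axioms)
  have "emeasure (random_subset p) {\<omega>. \<forall>a\<in>S. \<not> \<omega> a}
      = (\<Prod>a\<in>S. emeasure (measure_pmf (bernoulli_pmf (p a))) {False})"
    using emeasure_PiM_Collect[of S "\<lambda>_. {False}"] assms(1)
    by (simp add: random_subset_def space_PiM PiE_UNIV_domain)
  also have "\<dots> = (\<Prod>a\<in>S. ennreal (1 - p a))"
    using assms(2) by (intro prod.cong) (auto simp: emeasure_pmf_single)
  also have "\<dots> = ennreal (\<Prod>a\<in>S. 1 - p a)"
    using assms(2) by (intro prod_ennreal) auto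
  finally show ?thesis
    using assms(2) by (simp add: measure_def prod_nonneg)
qed

text \<open>The left side is 0 for empty \<open>S\<close> and at most 1 otherwise. This crude bound
  suffices, since only the total size of the overlaps is used later.\<close>

lemma one_minus_prod_le_card:
  fixes f :: "'a \<Rightarrow> real"
  assumes "finite S" "\<And>a. a \<in> S \<Longrightarrow> f a \<in> {0..1}"
  shows "1 - (\<Prod>a\<in>S. f a) \<le> real (card S)"
proof (cases "S = {}")
  case False
  then have "1 \<le> real (card S)"
    using assms(1) by (simp add: Suc_le_eq card_gt_0_iff)
  moreover have "0 \<le> (\<Prod>a\<in>S. f a)"
    using assms(2) by (intro prod_nonneg) auto
  ultimately show ?thesis by linarith
qed simp

text \<open>Two events of avoiding \<open>S n\<close> and \<open>S m\<close> are correlated only through \<open>S n \<inter> S m\<close>.\<close>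

lemma avoid_covariance_le_card_Int:
  assumes "finite S" "finite T" and p: "\<And>a. p a \<in> {0..1}"
  shows "(\<Prod>a\<in>S \<union> T. 1 - p a) - (\<Prod>a\<in>S. 1 - p a) * (\<Prod>a\<in>T. 1 - p a) \<le> real (card (S \<inter> T))"
proof -
  let ?u = "\<Prod>a\<in>S \<union> T. 1 - p a" and ?i = "\<Prod>a\<in>S \<inter> T. 1 - p a"
  \<comment> \<open>The product over \<open>S\<close> times that over \<open>T\<close> equals
    \<open>?u * ?i\<close>, since common factors occur twice.\<close>
  have "?u - (\<Prod>a\<in>S. 1 - p a) * (\<Prod>a\<in>T. 1 - p a) = ?u * (1 - ?i)"
    using prod.union_inter[OF assms(1,2), of "\<lambda>a. 1 - p a"] by (simp add: algebra_simps)
  also have "\<dots> \<le> 1 * (1 - ?i)"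
    using p by (intro mult_right_mono prod_le_1) (auto simp: prod_le_1)
  also have "\<dots> \<le> real (card (S \<inter> T))"
    using one_minus_prod_le_card[of "S \<inter> T" "\<lambda>a. 1 - p a"] assms by auto
  finally show ?thesis .
qed

text \<open>Double counting: the covariances sum to at most the total of all |S n \<inter> S m|,
  which is the sum over \<open>a\<close> of d(a)^2, where d(a) counts the \<open>n \<le> N\<close>
  with \<open>a \<in> S n\<close>. By \<open>overlap\<close>, d(a)^2 is at most sqrt (C N), which
  yields the N^(3/2) that the variance argument asks for.\<close>

lemma AE_random_subset_avoid_average:
  fixes S :: "nat \<Rightarrow> nat set" and p :: "nat \<Rightarrow> real"
  assumes p: "\<And>a. p a \<in> {0..1}"
    and S: "\<And>n. S n \<subseteq> {1..n}"
    and overlap: "\<And>a N. real (card {n\<in>{1..N}. a \<in> S n}) ^ 4 \<le> C * real N"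
  shows "AE \<omega> in random_subset p.
    (\<lambda>N. (\<Sum>n=1..N. of_bool (\<forall>a\<in>S n. \<not> \<omega> a) - (\<Prod>a\<in>S n. 1 - p a)) / real N) \<longlonglongrightarrow> 0"
proof -
  interpret prob_space "random_subset p" by (rule prob_space_random_subset)
  define V where "V n = {\<omega>. \<forall>a\<in>S n. \<not> \<omega> a}" for n
  have fin: "finite (S n)" for n using S finite_subset by blast
  have prob_V: "prob (V n) = (\<Prod>a\<in>S n. 1 - p a)" for n
    unfolding V_def by (intro measure_random_subset_avoid fin p)
  have V_Int: "prob (V n \<inter> V m) = (\<Prod>a\<in>S n \<union> S m. 1 - p a)" for n m
  proof -
    have "V n \<inter> V m = {\<omega>. \<forall>a\<in>S n \<union> S m. \<not> \<omega> a}" by (auto simp: V_def)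
    then show ?thesis using fin p by (simp add: measure_random_subset_avoid)
  qed
  have "(\<Sum>n=1..N. \<Sum>m=1..N. prob (V n \<inter> V m) - prob (V n) * prob (V m))
      \<le> sqrt C * (real N * sqrt (real N))" for N
  proof -
    define d where "d a = real (card {n\<in>{1..N}. a \<in> S n})" for a
    have d: "d a = (\<Sum>n=1..N. of_bool (a \<in> S n))" for a
    proof -
      have "{n\<in>{1..N}. a \<in> S n} = {1..N} \<inter> {n. a \<in> S n}" by auto
      then show ?thesis by (simp add: d_def of_bool_def sum.If_cases)
    qed
    have d_sq: "(d a)\<^sup>2 \<le> sqrt C * sqrt (real N)" for a
    proof -
      have "((d a)\<^sup>2)\<^sup>2 \<le> C * real N"
        using overlap[where a = a and N = N] by (simp add: d_def power_mult[symmetric])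
      then have "(d a)\<^sup>2 \<le> sqrt (C * real N)" by (rule real_le_rsqrt)
      then show ?thesis by (simp add: real_sqrt_mult)
    qed
    have "(\<Sum>n=1..N. \<Sum>m=1..N. prob (V n \<inter> V m) - prob (V n) * prob (V m))
        \<le> (\<Sum>n=1..N. \<Sum>m=1..N. real (card (S n \<inter> S m)))"
      unfolding V_Int prob_V by (intro sum_mono avoid_covariance_le_card_Int fin p)
    \<comment> \<open>Letting \<open>a\<close> run only up to \<open>N\<close> loses nothing,
      because \<open>S n \<subseteq> {1..n}\<close>.\<close>
    also have "\<dots> = (\<Sum>n=1..N. \<Sum>m=1..N. \<Sum>a=1..N. of_bool (a \<in> S n) * of_bool (a \<in> S m))"
    proof (intro sum.cong refl)
      fix n m assume "n \<in> {1..N}" "m \<in> {1..N}"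
      then have "S n \<inter> S m = {1..N} \<inter> {a. a \<in> S n \<and> a \<in> S m}"
        using S[of n] by auto
      then show "real (card (S n \<inter> S m)) = (\<Sum>a=1..N. of_bool (a \<in> S n) * of_bool (a \<in> S m))"
        by (simp add: of_bool_conj[symmetric] sum.If_cases)
    qed
    also have "\<dots> = (\<Sum>n=1..N. \<Sum>a=1..N. \<Sum>m=1..N. of_bool (a \<in> S n) * of_bool (a \<in> S m))"
      by (intro sum.cong refl sum.swap)
    also have "\<dots> = (\<Sum>a=1..N. \<Sum>n=1..N. \<Sum>m=1..N. of_bool (a \<in> S n) * of_bool (a \<in> S m))"
      by (rule sum.swap)
    also have "\<dots> = (\<Sum>a=1..N. (d a)\<^sup>2)"
      unfolding d power2_eq_square sum_product ..
    also have "\<dots> \<le> (\<Sum>a=1..N. sqrt C * sqrt (real N))"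
      by (intro sum_mono d_sq)
    finally show ?thesis by (simp add: mult_ac)
  qed
  from AE_average_indicator_minus_prob[OF _ this]
  have "AE \<omega> in random_subset p. (\<lambda>N. (\<Sum>n=1..N. indicator (V n) \<omega> - prob (V n)) / real N) \<longlonglongrightarrow> 0"
    using avoid_in_sets_random_subset[OF fin] by (simp add: V_def)
  moreover have "indicator (V n) \<omega> = (of_bool (\<forall>a\<in>S n. \<not> \<omega> a) :: real)" for n \<omega>
    by (simp add: V_def indicator_def)
  ultimately show ?thesis by (simp only: prob_V)
qed

section \<open>From averages to densities\<close>

text \<open>A Cesaro argument in which the limit is taken only along \<open>n\<close> outside
  \<open>E\<close>. Each of the fewer than \<open>m\<close> early terms and each term in
  \<open>E\<close> deviates from \<open>L\<close> by at most 1, and there are o(N) of these; every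
  other term deviates by at most e/3.\<close>

lemma average_tendsto_off_null_set:
  fixes q :: "nat \<Rightarrow> real"
  assumes E: "has_density E 0"
    and lim: "(q \<longlongrightarrow> L) (inf sequentially (principal (- E)))"
    and bounded: "\<And>n. \<bar>q n - L\<bar> \<le> 1"
  shows "(\<lambda>N. (\<Sum>n=1..N. q n) / real N) \<longlonglongrightarrow> L"
proof (rule LIMSEQ_I)
  fix e :: real assume "e > 0"
  then have "eventually (\<lambda>n. dist (q n) L < e / 3) (inf sequentially (principal (- E)))"
    by (intro tendstoD[OF lim]) auto
  then obtain m where m: "\<And>n. n \<ge> m \<Longrightarrow> n \<notin> E \<Longrightarrow> \<bar>q n - L\<bar> \<le> e / 3"
    by (force simp: eventually_inf_principal eventually_sequentially dist_real_def)
  have "(\<lambda>N. real m / real N) \<longlonglongrightarrow> 0" by real_asymp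
  then have "eventually (\<lambda>N. real m / real N < e / 3) sequentially"
    using \<open>e > 0\<close> by (intro order_tendstoD) auto
  moreover have "eventually (\<lambda>N. real (card (E \<inter> {1..N})) / real N < e / 3) sequentially"
    using E \<open>e > 0\<close> unfolding has_density_def by (intro order_tendstoD) auto
  moreover have "eventually (\<lambda>N::nat. N \<ge> 1) sequentially"
    by (rule eventually_ge_at_top)
  ultimately have "eventually (\<lambda>N. norm ((\<Sum>n=1..N. q n) / real N - L) < e) sequentially"
  proof eventually_elim
    case (elim N)
    have "\<bar>(\<Sum>n=1..N. q n) - real N * L\<bar> = \<bar>\<Sum>n=1..N. q n - L\<bar>"
      by (simp add: sum_subtractf)
    also have "\<dots> \<le> (\<Sum>n=1..N. of_bool (n < m) + of_bool (n \<in> E) + e / 3)"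
    proof (rule order_trans[OF sum_abs sum_mono])
      show "\<bar>q n - L\<bar> \<le> of_bool (n < m) + of_bool (n \<in> E) + e / 3" for n
        using m[of n] bounded[of n] \<open>e > 0\<close> by (cases "n < m"; cases "n \<in> E") auto
    qed
    also have "\<dots> = real (card ({1..N} \<inter> {n. n < m})) + real (card ({1..N} \<inter> E)) + real N * (e / 3)"
      by (simp add: sum.distrib of_bool_def sum.If_cases)
    also have "card ({1..N} \<inter> {n. n < m}) \<le> card {..<m}"
      by (intro card_mono) auto
    finally have "\<bar>(\<Sum>n=1..N. q n) - real N * L\<bar> \<le> real m + real (card (E \<inter> {1..N})) + real N * (e / 3)"
      by (simp add: Int_commute)
    also have "\<dots> < real N * e"
      using elim by (simp add: field_simps)
    finally have "\<bar>(\<Sum>n=1..N. q n) - real N * L\<bar> / real N < e"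
      using elim(3) by (simp add: field_simps)
    moreover have "(\<Sum>n=1..N. q n) / real N - L = ((\<Sum>n=1..N. q n) - real N * L) / real N"
      using elim(3) by (simp add: field_simps)
    ultimately show ?case by simp
  qed
  then show "\<exists>no. \<forall>n\<ge>no. norm ((\<Sum>n=1..n. q n) / real n - L) < e"
    by (simp add: eventually_sequentially)
qed

lemma has_densityI_average_not_mem:
  assumes "(\<lambda>N. (\<Sum>n=1..N. of_bool (n \<notin> S)) / real N) \<longlonglongrightarrow> 1 - \<alpha>"
  shows "has_density S \<alpha>"
proof -
  have eq: "1 - (\<Sum>n=1..N. of_bool (n \<notin> S)) / real N = real (card (S \<inter> {1..N})) / real N"
    if "N \<ge> 1" for N
  proof -
    have "(\<Sum>n=1..N. of_bool (n \<notin> S)) = (\<Sum>n=1..N. 1 - of_bool (n \<in> S) :: real)"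
      by (intro sum.cong) auto
    also have "\<dots> = real N - real (card (S \<inter> {1..N}))"
      by (simp add: sum_subtractf of_bool_def sum.If_cases Int_commute)
    finally have "1 - (\<Sum>n=1..N. of_bool (n \<notin> S)) / real N
        = 1 - (real N - real (card (S \<inter> {1..N}))) / real N" by (rule arg_cong)
    then show ?thesis using that by (simp add: field_simps)
  qed
  have "(\<lambda>N. 1 - (\<Sum>n=1..N. of_bool (n \<notin> S)) / real N) \<longlonglongrightarrow> 1 - (1 - \<alpha>)"
    using assms by (intro tendsto_diff tendsto_const)
  then have "(\<lambda>N. 1 - (\<Sum>n=1..N. of_bool (n \<notin> S)) / real N) \<longlonglongrightarrow> \<alpha>"
    by simp
  then show ?thesis
    unfolding has_density_def
    by (rule Lim_transform_eventually) (intro eventually_sequentiallyI[of 1] eq)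
qed

section \<open>Extracting a suitable set from the random model\<close>

text \<open>\<open>n\<close> is missed by \<open>A + B\<close> exactly when the random set avoids
  all \<open>n - x\<close> with \<open>x \<in> B\<close>, \<open>x < n\<close>; with inclusion
  probability \<open>1 - exp (- w a)\<close> this has probability exp of minus the sum of the
  weights. Almost every outcome gives the right averages for both \<open>A\<close> and
  \<open>A + B\<close>, so one outcome serves both.\<close>

lemma ex_null_set_sumset_density:
  fixes B E :: "nat set" and w :: "nat \<Rightarrow> real"
  assumes B: "B \<subseteq> {1..}"
    and sparse: "\<And>N. real (card (B \<inter> {1..N})) ^ 4 \<le> C * real N"
    and w_nonneg: "\<And>a. w a \<ge> 0" and w_lim: "w \<longlonglongrightarrow> 0"
    and E: "has_density E 0" and \<alpha>: "\<alpha> \<in> {0..1}"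
    and lim: "((\<lambda>n. exp (- (\<Sum>x\<in>B \<inter> {1..<n}. w (n - x)))) \<longlongrightarrow> 1 - \<alpha>)
                (inf sequentially (principal (- E)))"
  shows "\<exists>A\<subseteq>{1..}. has_density A 0 \<and> has_density (A + B) \<alpha>"
proof -
  define p where "p a = 1 - exp (- w a)" for a
  have p: "p a \<in> {0..1}" for a using w_nonneg[of a] by (simp add: p_def)
  define S where "S n = (\<lambda>x. n - x) ` (B \<inter> {1..<n})" for n
  have S: "S n \<subseteq> {1..n}" for n by (auto simp: S_def)
  have overlap: "real (card {n\<in>{1..N}. a \<in> S n}) ^ 4 \<le> C * real N" for a N
  proof -
    \<comment> \<open>For fixed \<open>a\<close>, each such \<open>n\<close> is \<open>x + a\<close>
      with \<open>x \<in> B\<close>, so the sparsity of \<open>B\<close> bounds the overlap.\<close>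
    have "{n\<in>{1..N}. a \<in> S n} \<subseteq> (\<lambda>x. x + a) ` (B \<inter> {1..N})"
    proof
      fix n assume "n \<in> {n\<in>{1..N}. a \<in> S n}"
      then obtain x where "n \<le> N" "x \<in> B" "1 \<le> x" "x < n" "a = n - x" by (auto simp: S_def)
      then show "n \<in> (\<lambda>x. x + a) ` (B \<inter> {1..N})" by (intro image_eqI[of _ _ x]) auto
    qed
    then have "card {n\<in>{1..N}. a \<in> S n} \<le> card (B \<inter> {1..N})"
      by (meson finite_Int finite_atLeastAtMost surj_card_le)
    then have "real (card {n\<in>{1..N}. a \<in> S n}) ^ 4 \<le> real (card (B \<inter> {1..N})) ^ 4"
      by (intro power_mono) auto
    with sparse[of N] show ?thesis by linarith
  qed
  \<comment> \<open>Avoiding \<open>{n}\<close> means \<open>n \<notin> A\<close>, so the same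
    averaging lemma also governs \<open>A\<close>. Intersecting with \<open>{1..}\<close> makes the
    set empty at \<open>n = 0\<close>, as containment in \<open>{1..n}\<close> demands.\<close>
  have overlap_singleton: "real (card {n\<in>{1..N}. a \<in> {n} \<inter> {1..}}) ^ 4 \<le> 1 * real N" for a N :: nat
  proof (cases "a \<in> {1..N}")
    case True
    then have "{n\<in>{1..N}. a \<in> {n} \<inter> {1..}} = {a}" by auto
    with True show ?thesis by simp
  next
    case False
    then have "{n\<in>{1..N}. a \<in> {n} \<inter> {1..}} = {}" by auto
    then show ?thesis by (simp del: Collect_empty_eq)
  qed
  interpret prob_space "random_subset p" by (rule prob_space_random_subset)
  have "AE \<omega> in random_subset p.
      (\<lambda>N. (\<Sum>n=1..N. of_bool (\<forall>a\<in>{n} \<inter> {1..}. \<not> \<omega> a) - (\<Prod>a\<in>{n} \<inter> {1..}. 1 - p a)) / real N) \<longlonglongrightarrow> 0 \<and>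
      (\<lambda>N. (\<Sum>n=1..N. of_bool (\<forall>a\<in>S n. \<not> \<omega> a) - (\<Prod>a\<in>S n. 1 - p a)) / real N) \<longlonglongrightarrow> 0"
    by (intro AE_conjI AE_random_subset_avoid_average[where C = 1] AE_random_subset_avoid_average[where C = C]
        p S overlap overlap_singleton) auto
  from eventually_happens'[OF ae_filter_bot this] obtain \<omega> where
    \<omega>1: "(\<lambda>N. (\<Sum>n=1..N. of_bool (\<forall>a\<in>{n} \<inter> {1..}. \<not> \<omega> a) - (\<Prod>a\<in>{n} \<inter> {1..}. 1 - p a)) / real N) \<longlonglongrightarrow> 0" and
    \<omega>2: "(\<lambda>N. (\<Sum>n=1..N. of_bool (\<forall>a\<in>S n. \<not> \<omega> a) - (\<Prod>a\<in>S n. 1 - p a)) / real N) \<longlonglongrightarrow> 0"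
    by blast
  define A where "A = {a. a \<ge> 1 \<and> \<omega> a}"
  have "has_density A 0"
  proof -
    \<comment> \<open>The exceptional set is empty here: the weights vanish in the limit along all
      \<open>n\<close>.\<close>
    have "((\<lambda>n. exp (- w n)) \<longlongrightarrow> exp (- 0)) (inf sequentially (principal (- {})))"
      using w_lim by (intro tendsto_intros) auto
    then have "(\<lambda>N. (\<Sum>n=1..N. exp (- w n)) / real N) \<longlonglongrightarrow> 1"
      using w_nonneg by (intro average_tendsto_off_null_set[of "{}"]) (auto simp: has_density_def)
    from tendsto_add[OF \<omega>1 this]
    have "(\<lambda>N. (\<Sum>n=1..N. of_bool (\<forall>a\<in>{n} \<inter> {1..}. \<not> \<omega> a) - (\<Prod>a\<in>{n} \<inter> {1..}. 1 - p a)) / real N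
        + (\<Sum>n=1..N. exp (- w n)) / real N) \<longlonglongrightarrow> 1 - 0" by simp
    moreover have "(\<Sum>n=1..N. of_bool (\<forall>a\<in>{n} \<inter> {1..}. \<not> \<omega> a) - (\<Prod>a\<in>{n} \<inter> {1..}. 1 - p a))
        = (\<Sum>n=1..N. of_bool (n \<notin> A) - exp (- w n))" for N
      by (intro sum.cong refl) (auto simp: A_def p_def)
    ultimately have "(\<lambda>N. (\<Sum>n=1..N. of_bool (n \<notin> A) - exp (- w n)) / real N
        + (\<Sum>n=1..N. exp (- w n)) / real N) \<longlonglongrightarrow> 1 - 0" by (simp only:)
    then show ?thesis
      by (intro has_densityI_average_not_mem) (simp only: sum_subtractf diff_divide_distrib diff_add_cancel)
  qed
  moreover have "has_density (A + B) \<alpha>"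
  proof -
    have inj: "inj_on (\<lambda>x. n - x) (B \<inter> {1..<n})" for n
      by (auto simp: inj_on_def)
    have prod_S: "(\<Prod>a\<in>S n. 1 - p a) = exp (- (\<Sum>x\<in>B \<inter> {1..<n}. w (n - x)))" for n
      unfolding S_def prod.reindex[OF inj] by (simp add: p_def sum_negf[symmetric] exp_sum)
    have "(\<Sum>x\<in>B \<inter> {1..<n}. w (n - x)) \<ge> 0" for n
      using w_nonneg by (intro sum_nonneg) auto
    then have exp_le: "exp (- (\<Sum>x\<in>B \<inter> {1..<n}. w (n - x))) \<le> 1" for n by simp
    have "\<bar>exp (- (\<Sum>x\<in>B \<inter> {1..<n}. w (n - x))) - (1 - \<alpha>)\<bar> \<le> 1" for n
      using exp_le[of n] exp_ge_zero[of "- (\<Sum>x\<in>B \<inter> {1..<n}. w (n - x))"] \<alpha>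
      unfolding abs_le_iff atLeastAtMost_iff by linarith
    from average_tendsto_off_null_set[OF E lim this]
    have "(\<lambda>N. (\<Sum>n=1..N. \<Prod>a\<in>S n. 1 - p a) / real N) \<longlonglongrightarrow> 1 - \<alpha>"
      unfolding prod_S .
    from tendsto_add[OF \<omega>2 this]
    have "(\<lambda>N. (\<Sum>n=1..N. of_bool (\<forall>a\<in>S n. \<not> \<omega> a)) / real N) \<longlonglongrightarrow> 0 + (1 - \<alpha>)"
      by (simp only: sum_subtractf diff_divide_distrib diff_add_cancel)
    moreover have "(\<forall>a\<in>S n. \<not> \<omega> a) \<longleftrightarrow> n \<notin> A + B" for n
    proof -
      have "n \<in> A + B \<longleftrightarrow> (\<exists>x\<in>B \<inter> {1..<n}. \<omega> (n - x))"
      proof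
        assume "n \<in> A + B"
        then obtain a x where ax: "a \<in> A" "x \<in> B" "n = a + x" by (auto simp: set_plus_def)
        with B show "\<exists>x\<in>B \<inter> {1..<n}. \<omega> (n - x)"
          by (intro bexI[of _ x]) (auto simp: A_def)
      next
        assume "\<exists>x\<in>B \<inter> {1..<n}. \<omega> (n - x)"
        then obtain x where x: "x \<in> B" "x < n" "\<omega> (n - x)" by auto
        then have "n - x \<in> A" by (auto simp: A_def)
        with x have "(n - x) + x \<in> A + B" by (intro set_plus_intro)
        with x show "n \<in> A + B" by simp
      qed
      then show ?thesis by (auto simp: S_def)
    qed
    ultimately show ?thesis
      by (intro has_densityI_average_not_mem) (simp only: add_0_left)
  qed
  moreover have "A \<subseteq> {1..}" by (auto simp: A_def)
  ultimately show ?thesis by blast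
qed

section \<open>Counting function and growth of the enumeration\<close>

locale lacunary_enumeration =
  fixes B :: "nat set" and b r :: "nat \<Rightarrow> nat"
  assumes B: "B \<subseteq> {1..}"
    and enum: "increasing_enumeration b B"
    and r_less: "\<And>n. n \<ge> 2 \<Longrightarrow> r n < n"
    and r_small: "(\<lambda>n. real (r n)) \<in> o(\<lambda>n. real n)"
    and null: "has_density (exceptional_set b r) 0"
begin

lemma b_less_iff: "i \<ge> 1 \<Longrightarrow> j \<ge> 1 \<Longrightarrow> b i < b j \<longleftrightarrow> i < j"
  using enum unfolding increasing_enumeration_def
  by (metis atLeast_iff strict_mono_on_less)

lemma b_le_iff: "i \<ge> 1 \<Longrightarrow> j \<ge> 1 \<Longrightarrow> b i \<le> b j \<longleftrightarrow> i \<le> j"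
  using b_less_iff[of j i] by auto

lemma image_b: "b ` {1..} = B"
  using enum by (simp add: increasing_enumeration_def)

lemma b_ge_index: "i \<ge> 1 \<Longrightarrow> i \<le> b i"
proof (induction i rule: dec_induct)
  case base
  have "b 1 \<in> B" using image_b by blast
  with B show ?case by auto
next
  case (step i)
  then show ?case using b_less_iff[of i "Suc i"] by simp
qed

definition count :: "nat \<Rightarrow> nat" where
  "count n = card (B \<inter> {1..n})"

text \<open>\<open>b\<close> and \<open>count\<close> form a Galois connection: the indices
  \<open>i \<ge> 1\<close> with \<open>b i \<le> n\<close> form an initial segment, and
  \<open>b\<close> maps it bijectively onto \<open>B \<inter> {1..n}\<close>.\<close>

lemma b_le_iff_le_count:
  assumes "i \<ge> 1"
  shows "b i \<le> n \<longleftrightarrow> i \<le> count n"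
proof -
  define I where "I = {i. i \<ge> 1 \<and> b i \<le> n}"
  have "I \<subseteq> {1..n}" using b_ge_index unfolding I_def by fastforce
  then have fin: "finite I" using finite_subset by blast
  have "\<exists>m. I = {1..m}"
  proof (cases "I = {}")
    case False
    have "I = {1..Max I}"
    proof
      show "I \<subseteq> {1..Max I}" using fin by (auto simp: I_def)
      have "Max I \<in> I" using fin False by (rule Max_in)
      then have Max: "Max I \<ge> 1" "b (Max I) \<le> n" by (simp_all add: I_def)
      show "{1..Max I} \<subseteq> I"
      proof
        fix i assume "i \<in> {1..Max I}"
        then show "i \<in> I" using b_le_iff[of i "Max I"] Max by (simp add: I_def)
      qed
    qed
    then show ?thesis ..
  qed (auto intro: exI[of _ 0])
  then obtain m where m: "I = {1..m}" ..
  have "B \<inter> {1..n} = b ` I"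
    using image_b B by (auto simp: I_def)
  moreover have "inj_on b I"
    by (rule inj_onI) (metis I_def b_less_iff linorder_neq_iff mem_Collect_eq)
  ultimately have "count n = m"
    by (simp add: count_def card_image m)
  moreover have "b i \<le> n \<longleftrightarrow> i \<in> I" using assms by (simp add: I_def)
  ultimately show ?thesis using m assms by simp
qed

lemma count_mono: "m \<le> n \<Longrightarrow> count m \<le> count n"
  unfolding count_def by (intro card_mono) auto

lemma count_at_top: "filterlim count at_top sequentially"
  unfolding filterlim_at_top
proof
  fix k
  show "eventually (\<lambda>n. k \<le> count n) sequentially"
  proof (rule eventually_sequentiallyI)
    \<comment> \<open>\<open>Suc k\<close> keeps the index at least 1 even for
      \<open>k = 0\<close>.\<close>
    fix n assume "b (Suc k) \<le> n"
    then show "k \<le> count n" using b_le_iff_le_count[of "Suc k" n] by simp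
  qed
qed

text \<open>Since \<open>r k \<le> k / 2\<close> eventually, an initial segment of length \<open>b (k div 2)\<close> of
  \<open>[b k, 2 b k)\<close> lies in a null set, so \<open>b (k div 2) / b k\<close> tends to \<open>0\<close>; this forces
  superpolynomial growth, of which the fourth power suffices.\<close>

lemma eventually_b_half: "eventually (\<lambda>k. 81 * b (k div 2) \<le> b k) sequentially"
proof -
  let ?E = "exceptional_set b r"
  \<comment> \<open>162 is 2 * 81: below, \<open>162 * c \<le> b k + c\<close> and
    \<open>c \<le> b k\<close> give \<open>81 * c \<le> b k\<close>.\<close>
  have "eventually (\<lambda>n. real (card (?E \<inter> {1..n})) / real n < 1 / 162) sequentially"
    using null unfolding has_density_def by (intro order_tendstoD) auto
  then obtain m where m: "\<And>n. n \<ge> m \<Longrightarrow> real (card (?E \<inter> {1..n})) / real n < 1 / 162"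
    by (auto simp: eventually_sequentially)
  have "eventually (\<lambda>k. real (r k) \<le> 1 / 2 * real k) sequentially"
    using landau_o.smallD[OF r_small, of "1 / 2"] by simp
  moreover have "eventually (\<lambda>k. k \<ge> max m 2) sequentially"
    by (rule eventually_ge_at_top)
  ultimately show ?thesis
  proof eventually_elim
    case (elim k)
    define c where "c = b (k - r k)"
    have "k div 2 \<ge> 1" using elim(2) by linarith
    have "2 * r k \<le> k" using elim(1) by linarith
    then have "k div 2 \<le> k - r k" by linarith
    then have half_le: "b (k div 2) \<le> c"
      using \<open>k div 2 \<ge> 1\<close> b_le_iff[of "k div 2" "k - r k"] unfolding c_def by linarith
    have "c \<le> b k"
      using r_less[of k] elim(2) b_le_iff[of "k - r k" k] unfolding c_def by simp
    have "k \<le> b k" using b_ge_index elim(2) by simp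
    have "{b k..<b k + c} \<subseteq> ?E \<inter> {1..b k + c}"
      using elim(2) \<open>k \<le> b k\<close> unfolding exceptional_set_def c_def by auto
    from card_mono[OF _ this] have "c \<le> card (?E \<inter> {1..b k + c})" by simp
    moreover have "real (card (?E \<inter> {1..b k + c})) < 1 / 162 * real (b k + c)"
      using m[of "b k + c"] elim(2) \<open>k \<le> b k\<close> by (simp add: field_simps)
    ultimately have "real c < 1 / 162 * real (b k + c)" by linarith
    then have "real (162 * c) \<le> real (b k + c)" by simp
    then have "162 * c \<le> b k + c" by (simp only: of_nat_le_iff)
    with \<open>c \<le> b k\<close> half_le show ?case by linarith
  qed
qed

text \<open>Here 81 = 3^4: halving the index shrinks \<open>k\<close> by a factor of at most 3 but
  \<open>b k\<close> by at least 81, so the ratio of k^4 to \<open>b k\<close> never gets worse. The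
  constant \<open>(m + 2) ^ 4\<close> absorbs the small \<open>k\<close>, where
  \<open>b k \<ge> 1\<close>.\<close>

lemma b_growth: "\<exists>C. \<forall>k\<ge>1. k ^ 4 \<le> C * b k"
proof -
  obtain m where m: "\<And>k. k \<ge> m \<Longrightarrow> 81 * b (k div 2) \<le> b k"
    using eventually_b_half by (auto simp: eventually_sequentially)
  define C where "C = (m + 2) ^ 4"
  have "k ^ 4 \<le> C * b k" if "k \<ge> 1" for k
    using that
  proof (induction k rule: less_induct)
    case (less k)
    show ?case
    proof (cases "k \<ge> m + 2")
      case True
      let ?h = "k div 2"
      have "k \<le> 3 * ?h" using True by linarith
      then have "k ^ 4 \<le> (3 * ?h) ^ 4" by (rule power_mono) simp
      also have "\<dots> = 81 * ?h ^ 4" by (simp add: power_mult_distrib)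
      also have "\<dots> \<le> 81 * (C * b ?h)" using less.IH[of ?h] True by simp
      also have "\<dots> = C * (81 * b ?h)" by simp
      also have "\<dots> \<le> C * b k" using m[of k] True by (intro mult_left_mono) auto
      finally show ?thesis .
    next
      case False
      then have "k ^ 4 \<le> C" unfolding C_def by (intro power_mono) auto
      also have "\<dots> \<le> C * b k" using b_ge_index[of k] less.prems by simp
      finally show ?thesis .
    qed
  qed
  then show ?thesis by blast
qed

lemma count_growth: "\<exists>C. \<forall>n. real (count n) ^ 4 \<le> C * real n"
proof -
  obtain C where C: "\<And>k. k \<ge> 1 \<Longrightarrow> k ^ 4 \<le> C * b k"
    using b_growth by blast
  have "count n ^ 4 \<le> C * n" for n
  proof (cases "count n \<ge> 1")
    case True
    then have "b (count n) \<le> n" using b_le_iff_le_count by blast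
    then have "C * b (count n) \<le> C * n" by simp
    with C[OF True] show ?thesis by linarith
  qed (simp add: not_le)
  then have "real (count n) ^ 4 \<le> real C * real n" for n
    by (metis of_nat_le_iff of_nat_mult of_nat_power)
  then show ?thesis by blast
qed

section \<open>Weight sums at non-exceptional integers\<close>

text \<open>With \<open>k = count n\<close>, \<open>n\<close> is at least \<open>b k\<close> but
  outside the \<open>k\<close>-th exceptional interval, so \<open>n \<ge> b k + b (k - r k)\<close>.
  Hence \<open>n \<notin> B\<close>, and each \<open>x \<in> B\<close> below \<open>n\<close>
  satisfies \<open>x \<le> b k\<close>, so \<open>n - x \<ge> b (k - r k)\<close>.
  \<open>count n \<ge> 2\<close> is there because the exceptional intervals start at index
  2.\<close>

lemma outside_exceptional_set:
  assumes n: "n \<notin> exceptional_set b r" "count n \<ge> 2"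
  shows "card (B \<inter> {1..<n}) = count n"
    and "x \<in> B \<inter> {1..<n} \<Longrightarrow> count n - r (count n) \<le> count (n - x)"
proof -
  let ?k = "count n"
  have idx: "?k - r ?k \<ge> 1" using r_less[OF n(2)] by simp
  have "b ?k \<le> n" using b_le_iff_le_count n(2) by simp
  moreover have "b ?k \<ge> 1" using b_ge_index[of ?k] n(2) by simp
  moreover have "n \<notin> {b ?k..<b ?k + b (?k - r ?k)} \<inter> {1..}"
    using n unfolding exceptional_set_def by blast
  ultimately have n_ge: "b ?k + b (?k - r ?k) \<le> n" by auto
  have x_le: "x \<le> b ?k" if x: "x \<in> B" "x \<le> n" for x
  proof -
    obtain i where "i \<ge> 1" "x = b i" using x image_b by auto
    with x n(2) show ?thesis using b_le_iff_le_count[of i n] b_le_iff[of i ?k] by simp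
  qed
  have "b ?k < n" using n_ge b_ge_index[OF idx] idx by linarith
  then have "n \<notin> B" using x_le[of n] by auto
  then have "B \<inter> {1..<n} = B \<inter> {1..n}" by (auto simp: less_le)
  then show "card (B \<inter> {1..<n}) = ?k" by (simp add: count_def)
  show "?k - r ?k \<le> count (n - x)" if "x \<in> B \<inter> {1..<n}"
  proof -
    have "b (?k - r ?k) \<le> n - x" using x_le[of x] that n_ge by auto
    then show ?thesis using b_le_iff_le_count[OF idx] by blast
  qed
qed

lemma filterlim_count_outside:
  "filterlim count at_top (inf sequentially (principal (- exceptional_set b r)))"
  using count_at_top by (rule filterlim_mono) auto

lemma eventually_outside:
  assumes "\<And>n. n \<notin> exceptional_set b r \<Longrightarrow> count n \<ge> 2 \<Longrightarrow> P n"
  shows "eventually P (inf sequentially (principal (- exceptional_set b r)))"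
proof -
  have "eventually (\<lambda>n. count n \<ge> 2) sequentially"
    using count_at_top by (simp add: filterlim_at_top)
  then show ?thesis
    unfolding eventually_inf_principal by eventually_elim (auto intro: assms)
qed

text \<open>With \<open>k = count n\<close> there are \<open>k\<close> summands, each between
  \<open>c / k\<close> and \<open>c / (k - r k)\<close>, so the sum lies between \<open>c\<close>
  and \<open>c / (1 - r k / k)\<close>.\<close>

lemma sum_inverse_count_tendsto:
  assumes "c \<ge> 0"
  shows "((\<lambda>n. \<Sum>x\<in>B \<inter> {1..<n}. c / real (count (n - x))) \<longlongrightarrow> c)
           (inf sequentially (principal (- exceptional_set b r)))"
proof (rule tendsto_sandwich)
  let ?F = "inf sequentially (principal (- exceptional_set b r))"
  show "((\<lambda>_. c) \<longlongrightarrow> c) ?F" by simp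
  have "(\<lambda>k. real (r k) / real k) \<longlonglongrightarrow> 0"
    using r_small by (rule smalloD_tendsto)
  then have "(\<lambda>k. c / (1 - real (r k) / real k)) \<longlonglongrightarrow> c / (1 - 0)"
    by (intro tendsto_intros) auto
  then show "((\<lambda>n. c / (1 - real (r (count n)) / real (count n))) \<longlongrightarrow> c) ?F"
    using filterlim_compose[OF _ filterlim_count_outside] by auto
  show "eventually (\<lambda>n. c \<le> (\<Sum>x\<in>B \<inter> {1..<n}. c / real (count (n - x)))) ?F"
  proof (rule eventually_outside)
    fix n assume n: "n \<notin> exceptional_set b r" "count n \<ge> 2"
    have "c = (\<Sum>x\<in>B \<inter> {1..<n}. c / real (count n))"
      using n outside_exceptional_set(1)[OF n] by simp
    also have "\<dots> \<le> (\<Sum>x\<in>B \<inter> {1..<n}. c / real (count (n - x)))"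
    proof (intro sum_mono divide_left_mono)
      fix x assume x: "x \<in> B \<inter> {1..<n}"
      show "real (count (n - x)) \<le> real (count n)" by (simp add: count_mono)
      show "0 < real (count n) * real (count (n - x))"
        using outside_exceptional_set(2)[OF n x] r_less[OF n(2)] n(2) by simp
    qed (use assms in auto)
    finally show "c \<le> (\<Sum>x\<in>B \<inter> {1..<n}. c / real (count (n - x)))" .
  qed
  show "eventually (\<lambda>n. (\<Sum>x\<in>B \<inter> {1..<n}. c / real (count (n - x)))
      \<le> c / (1 - real (r (count n)) / real (count n))) ?F"
  proof (rule eventually_outside)
    fix n assume n: "n \<notin> exceptional_set b r" "count n \<ge> 2"
    let ?k = "count n"
    have "(\<Sum>x\<in>B \<inter> {1..<n}. c / real (count (n - x))) \<le> (\<Sum>x\<in>B \<inter> {1..<n}. c / real (?k - r ?k))"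
    proof (intro sum_mono divide_left_mono)
      fix x assume x: "x \<in> B \<inter> {1..<n}"
      show "real (?k - r ?k) \<le> real (count (n - x))"
        using outside_exceptional_set(2)[OF n x] by linarith
      then show "0 < real (count (n - x)) * real (?k - r ?k)"
        using r_less[OF n(2)] by (intro mult_pos_pos) linarith+
    qed (use assms in auto)
    also have "\<dots> = c / (1 - real (r ?k) / real ?k)"
      using outside_exceptional_set(1)[OF n] r_less[OF n(2)] n(2) by (simp add: field_simps of_nat_diff)
    finally show "(\<Sum>x\<in>B \<inter> {1..<n}. c / real (count (n - x))) \<le> c / (1 - real (r ?k) / real ?k)" .
  qed
qed

text \<open>All \<open>k = count n\<close> summands are at least 1 / sqrt k, so the sum is at least
  sqrt k. This serves \<open>\<alpha> = 1\<close>, where the weights must vanish while their sums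
  diverge.\<close>

lemma sum_inverse_sqrt_count_at_top:
  "filterlim (\<lambda>n. \<Sum>x\<in>B \<inter> {1..<n}. 1 / sqrt (real (count (n - x)))) at_top
     (inf sequentially (principal (- exceptional_set b r)))"
proof (rule filterlim_at_top_mono)
  have "filterlim (\<lambda>k. sqrt (real k)) at_top sequentially" by real_asymp
  then show "filterlim (\<lambda>n. sqrt (real (count n))) at_top
      (inf sequentially (principal (- exceptional_set b r)))"
    by (rule filterlim_compose[OF _ filterlim_count_outside])
  show "eventually (\<lambda>n. sqrt (real (count n)) \<le> (\<Sum>x\<in>B \<inter> {1..<n}. 1 / sqrt (real (count (n - x)))))
      (inf sequentially (principal (- exceptional_set b r)))"
  proof (rule eventually_outside)
    fix n assume n: "n \<notin> exceptional_set b r" "count n \<ge> 2"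
    have "sqrt (real (count n)) = (\<Sum>x\<in>B \<inter> {1..<n}. 1 / sqrt (real (count n)))"
      using outside_exceptional_set(1)[OF n] by (simp add: real_div_sqrt)
    also have "\<dots> \<le> (\<Sum>x\<in>B \<inter> {1..<n}. 1 / sqrt (real (count (n - x))))"
    proof (intro sum_mono divide_left_mono)
      fix x assume x: "x \<in> B \<inter> {1..<n}"
      show "sqrt (real (count (n - x))) \<le> sqrt (real (count n))" by (simp add: count_mono)
      show "0 < sqrt (real (count n)) * sqrt (real (count (n - x)))"
        using outside_exceptional_set(2)[OF n x] r_less[OF n(2)] n(2) by simp
    qed auto
    finally show "sqrt (real (count n)) \<le> (\<Sum>x\<in>B \<inter> {1..<n}. 1 / sqrt (real (count (n - x))))" .
  qed
qed

section \<open>Choice of the weights\<close>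

lemma ex_null_set_sumset_density_eq:
  assumes "\<alpha> \<in> {0..1}"
  shows "\<exists>A\<subseteq>{1..}. has_density A 0 \<and> has_density (A + B) \<alpha>"
proof -
  obtain C where C: "\<And>n. real (card (B \<inter> {1..n})) ^ 4 \<le> C * real n"
    using count_growth unfolding count_def by blast
  show ?thesis
  proof (cases "\<alpha> = 1")
    case True
    \<comment> \<open>For \<open>a\<close> below the least element of \<open>B\<close>,
      \<open>count a = 0\<close> and the weight is 0 by the convention on division; the same holds
      for the weights in the other case.\<close>
    have w: "(\<lambda>a. 1 / sqrt (real (count a))) \<longlonglongrightarrow> 0"
    proof -
      have "(\<lambda>k. 1 / sqrt (real k)) \<longlonglongrightarrow> 0" by real_asymp
      then show ?thesis by (rule filterlim_compose[OF _ count_at_top])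
    qed
    have "((\<lambda>n. exp (- (\<Sum>x\<in>B \<inter> {1..<n}. 1 / sqrt (real (count (n - x)))))) \<longlongrightarrow> 1 - \<alpha>)
        (inf sequentially (principal (- exceptional_set b r)))"
      using filterlim_compose[OF exp_at_bot
          filterlim_compose[OF filterlim_uminus_at_bot_at_top sum_inverse_sqrt_count_at_top]]
      unfolding True diff_self .
    then show ?thesis
      by (rule ex_null_set_sumset_density[OF B C _ w null assms, rotated]) simp
  next
    case False
    define c where "c = - ln (1 - \<alpha>)"
    have "c \<ge> 0" using assms False unfolding c_def by simp
    have w: "(\<lambda>a. c / real (count a)) \<longlonglongrightarrow> 0"
    proof -
      have "(\<lambda>k. c / real k) \<longlonglongrightarrow> 0" by real_asymp
      then show ?thesis by (rule filterlim_compose[OF _ count_at_top])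
    qed
    have exp_c: "exp (- c) = 1 - \<alpha>" using assms False by (simp add: c_def)
    have "((\<lambda>n. exp (- (\<Sum>x\<in>B \<inter> {1..<n}. c / real (count (n - x))))) \<longlongrightarrow> 1 - \<alpha>)
        (inf sequentially (principal (- exceptional_set b r)))"
      unfolding exp_c[symmetric] by (intro tendsto_exp tendsto_minus sum_inverse_count_tendsto \<open>c \<ge> 0\<close>)
    then show ?thesis
      by (rule ex_null_set_sumset_density[OF B C _ w null assms, rotated]) (use \<open>c \<ge> 0\<close> in simp)
  qed
qed

end

theorem theorem1p2:
  fixes B :: "nat set" and b r :: "nat \<Rightarrow> nat"
  assumes "B \<subseteq> {1..}" and "infinite B"
    and "increasing_enumeration b B"
    and "\<forall>n\<ge>1. r n \<ge> 1"
    and "\<forall>n\<ge>2. r n < n"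
    and "(\<lambda>n. real (r n)) \<in> o(\<lambda>n. real n)"
    and "has_density (exceptional_set b r) 0"
  shows "\<forall>\<alpha>\<in>{0..1::real}. \<exists>A\<subseteq>{1..}. has_density A 0 \<and> has_density (A + B) \<alpha>"
proof -
  interpret lacunary_enumeration B b r
    using assms by unfold_locales auto
  show ?thesis using ex_null_set_sumset_density_eq by blast
qed

end
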